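(* Let $\mathcal H^{pe}$ be the Hopf algebra of vf-safe delta-matroids with coproduct $\Delta(D)=\sum_{A\subseteq E}D/A^c\otimes(D+A)/A$, and let $\alpha(\mathbf a,\mathbf b)=\exp_*(\delta_{\mathbf a})*\exp_*(\delta_{\mathbf b})$ with $\delta_{\mathbf a}=\sqrt{x_1x_2}\,\delta_c+x_1\delta_o+x_2\delta_n$ and $\delta_{\mathbf b}=\sqrt{y_1y_2}\,\delta_c+y_1\delta_o+y_2\delta_n$. Then for every vf-safe delta-matroid $D$ with ground set $E$, $$\alpha(\mathbf a,\mathbf b)(D)=x_1^{\xi(D)}\,y_2^{|E|-\xi(D)}\,\widetilde P_D\Big(\frac{y_1}{x_1}+1,\frac{x_2}{y_2}+1\Big).$$
   Context: A delta-matroid $D=(E,\mathcal F)$: finite $E$ and nonempty family $\mathcal F$ of subsets (feasible sets) with: for $X,Y\in\mathcal F$ and $u\in X\triangle Y$ there is $v\in X\triangle Y$ with $X\triangle\{u,v\}\in\mathcal F$. $e$ is a coloop if in every feasible set, a loop if in none. If $e$ is not a loop, $D/e=(E\setminus e,\{F\setminus e:e\in F\in\mathcal F\})$; if $e$ is not a coloop, $D\backslash e=(E\setminus e,\{F\in\mathcal F:e\notin F\})$; if $e$ is a loop or coloop, $D/e$ and $D\backslash e$ are both the one that is defined. Twist: $D*A=(E,\{A\triangle X:X\in\mathcal F\})$. Loop complementation: $D+e=(E,\mathcal F\triangle\{F\cup e:F\in\mathcal F,e\notin F\})$, and $D+A$ applies this to each element of $A$ (order irrelevant). $D$ is vf-safe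 if every sequence of twists and loop complementations yields a delta-matroid. Direct sum: $(E_1\cup E_2,\{F_1\cup F_2\})$. $\mathcal H^{pe}$ is the free module (over a field of characteristic 0) spanned by isomorphism classes of vf-safe delta-matroids, graded by $|E|$, multiplication direct sum, counit $1$ on the empty delta-matroid and $0$ otherwise. $\delta_c,\delta_o,\delta_n$ are the linear maps equal to $1$ respectively on $(\{e\},\{\{e\}\})$, $(\{e\},\{\emptyset\})$, $(\{e\},\{\emptyset,\{e\}\})$ and $0$ otherwise. $f*g=m\circ(f\otimes g)\circ\Delta$, $\exp_*(\delta)=\sum_{k\ge0}\delta^{*k}/k!$ with $\delta^{*0}=\varepsilon$. $r_{\max}(D)$ is the maximum cardinality of a feasible set. For $A\subseteq E$: $\xi(A)=\frac12(|A|+r_{\max}(D+A)-r_{\max}(D))$, $\xi(D)=\xi(E)$, and $\widetilde P_D(x,y)=\sum_{A\subseteq E}(x-1)^{\xi(E)-\xi(A)}(y-1)^{|A|-\xi(A)}$. *)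

theory Defs
  imports Complex_Main "HOL-Library.Poly_Mapping"
begin

section \<open>Delta-matroids\<close>

text \<open>Ground set and family of feasible sets.\<close>
type_synonym 'a set_system = "'a set \<times> 'a set set"

abbreviation ground :: "'a set_system \<Rightarrow> 'a set" where "ground \<equiv> fst"
abbreviation feasible :: "'a set_system \<Rightarrow> 'a set set" where "feasible \<equiv> snd"

definition delta_matroid :: "'a set_system \<Rightarrow> bool" where
  "delta_matroid D \<longleftrightarrow>
     finite (ground D) \<and> feasible D \<noteq> {} \<and> (\<forall>F\<in>feasible D. F \<subseteq> ground D) \<and>
     (\<forall>X\<in>feasible D. \<forall>Y\<in>feasible D. \<forall>u\<in>sym_diff X Y.
        \<exists>v\<in>sym_diff X Y. sym_diff X {u, v} \<in> feasible D)"

definition is_loop :: "'a set_system \<Rightarrow> 'a \<Rightarrow> bool" where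
  "is_loop D e \<longleftrightarrow> e \<in> ground D \<and> (\<forall>F\<in>feasible D. e \<notin> F)"

definition twist :: "'a set_system \<Rightarrow> 'a set \<Rightarrow> 'a set_system" where
  "twist D A = (ground D, (\<lambda>X. sym_diff A X) ` feasible D)"

definition loop_compl :: "'a set_system \<Rightarrow> 'a \<Rightarrow> 'a set_system" where
  "loop_compl D e =
     (ground D, sym_diff (feasible D) {insert e F | F. F \<in> feasible D \<and> e \<notin> F})"

definition loop_compl_set :: "'a set_system \<Rightarrow> 'a set \<Rightarrow> 'a set_system" where
  "loop_compl_set D A = Finite_Set.fold (\<lambda>e D'. loop_compl D' e) D A"

text \<open>If \<open>e\<close> is a loop then \<open>D / e\<close> means the deletion \<open>D \ e\<close>.\<close>
definition contract :: "'a set_system \<Rightarrow> 'a \<Rightarrow> 'a set_system" where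
  "contract D e =
     (if is_loop D e then (ground D - {e}, {F \<in> feasible D. e \<notin> F})
      else (ground D - {e}, {F - {e} | F. F \<in> feasible D \<and> e \<in> F}))"

text \<open>Contraction of the elements of \<open>A\<close> one after the other.  On delta-matroids the result does not
  depend on the order; \<open>Finite_Set.fold\<close> denotes the common value.\<close>
definition contract_set :: "'a set_system \<Rightarrow> 'a set \<Rightarrow> 'a set_system" where
  "contract_set D A = Finite_Set.fold (\<lambda>e D'. contract D' e) D A"

text \<open>The results of sequences of twists and loop complementations applied to \<open>D\<close>.\<close>
inductive vf_reachable :: "'a set_system \<Rightarrow> 'a set_system \<Rightarrow> bool" for D where
  refl: "vf_reachable D D"
| twist: "vf_reachable D D' \<Longrightarrow> A \<subseteq> ground D' \<Longrightarrow> vf_reachable D (twist D' A)"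
| loop_compl: "vf_reachable D D' \<Longrightarrow> e \<in> ground D' \<Longrightarrow> vf_reachable D (loop_compl D' e)"

definition vf_safe :: "'a set_system \<Rightarrow> bool" where
  "vf_safe D \<longleftrightarrow> (\<forall>D'. vf_reachable D D' \<longrightarrow> delta_matroid D')"

definition dm_iso :: "'a set_system \<Rightarrow> 'b set_system \<Rightarrow> bool" where
  "dm_iso D D' \<longleftrightarrow>
     (\<exists>f. bij_betw f (ground D) (ground D') \<and> feasible D' = (\<lambda>F. f ` F) ` feasible D)"


section \<open>The coalgebra of vf-safe delta-matroids\<close>

lemma vf_safe_empty: "vf_safe ({}, {{}})"
proof -
  have "D' = ({}, {{}})" if "vf_reachable ({}, {{}}) D'" for D' :: "'a set_system"
    using that by induction (auto simp: twist_def)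
  then show ?thesis
    by (auto simp: vf_safe_def delta_matroid_def)
qed

text \<open>Since ground sets are finite, every isomorphism class has representatives whose ground set
  consists of natural numbers; a class is represented by the set of all of these.\<close>
typedef dm_class = "{{D' :: nat set_system. dm_iso D D'} | D :: nat set_system. vf_safe D}"
  using vf_safe_empty by blast

definition class_of :: "'a set_system \<Rightarrow> dm_class" where
  "class_of D = Abs_dm_class {D' :: nat set_system. dm_iso D D'}"

definition rep :: "dm_class \<Rightarrow> nat set_system" where
  "rep c = (SOME D. D \<in> Rep_dm_class c)"

text \<open>The free module on isomorphism classes.  Its tensor square is the free module on pairs of
  classes.  Convolution of functionals involves the comultiplication and the counit of the Hopf
  algebra, but not its multiplication (direct sum).\<close>
type_synonym 'k hpe = "dm_class \<Rightarrow>\<^sub>0 'k"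
type_synonym 'k hpe2 = "(dm_class \<times> dm_class) \<Rightarrow>\<^sub>0 'k"

definition basis :: "'a set_system \<Rightarrow> 'k::field_char_0 hpe" where
  "basis D = Poly_Mapping.single (class_of D) 1"

text \<open>The linear extension of \<open>D \<mapsto> \<Sum>A\<subseteq>E. D / (E - A) \<otimes> (D + A) / A\<close>.\<close>
definition comult :: "'k::field_char_0 hpe \<Rightarrow> 'k hpe2" where
  "comult v = (\<Sum>c\<in>Poly_Mapping.keys v. \<Sum>A\<in>Pow (ground (rep c)).
     Poly_Mapping.single
       (class_of (contract_set (rep c) (ground (rep c) - A)),
        class_of (contract_set (loop_compl_set (rep c) A) A))
       (Poly_Mapping.lookup v c))"

text \<open>The linear functional taking the value 1 on the class of \<open>D\<close> and 0 on all other classes.\<close>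
definition dual :: "'a set_system \<Rightarrow> 'k::field_char_0 hpe \<Rightarrow> 'k" where
  "dual D v = Poly_Mapping.lookup v (class_of D)"

definition counit :: "'k::field_char_0 hpe \<Rightarrow> 'k" where
  "counit = dual ({} :: unit set, {{}})"

definition delta_c :: "'k::field_char_0 hpe \<Rightarrow> 'k" where
  "delta_c = dual ({()}, {{()}})"

definition delta_o :: "'k::field_char_0 hpe \<Rightarrow> 'k" where
  "delta_o = dual ({()}, {{}})"

definition delta_n :: "'k::field_char_0 hpe \<Rightarrow> 'k" where
  "delta_n = dual ({()}, {{}, {()}})"

text \<open>\<open>f \<otimes> g\<close> for linear functionals \<open>f\<close> and \<open>g\<close>, followed by the multiplication of the field.\<close>
definition mult_tensor ::
    "('k::field_char_0 hpe \<Rightarrow> 'k) \<Rightarrow> ('k hpe \<Rightarrow> 'k) \<Rightarrow> 'k hpe2 \<Rightarrow> 'k" where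
  "mult_tensor f g w = (\<Sum>(c, d)\<in>Poly_Mapping.keys w.
     Poly_Mapping.lookup w (c, d) * (f (Poly_Mapping.single c 1) * g (Poly_Mapping.single d 1)))"

definition conv ::
    "('k::field_char_0 hpe \<Rightarrow> 'k) \<Rightarrow> ('k hpe \<Rightarrow> 'k) \<Rightarrow> ('k hpe \<Rightarrow> 'k)" where
  "conv f g v = mult_tensor f g (comult v)"

definition conv_pow :: "('k::field_char_0 hpe \<Rightarrow> 'k) \<Rightarrow> nat \<Rightarrow> ('k hpe \<Rightarrow> 'k)" where
  "conv_pow f k = (conv f ^^ k) counit"

text \<open>For a functional \<open>f\<close> vanishing on the empty delta-matroid, only finitely many summands are
  nonzero at any given \<open>v\<close>; \<open>Sum_any\<close> is the sum over these.\<close>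
definition conv_exp :: "('k::field_char_0 hpe \<Rightarrow> 'k) \<Rightarrow> ('k hpe \<Rightarrow> 'k)" where
  "conv_exp f v = Sum_any (\<lambda>k. conv_pow f k v / fact k)"


section \<open>The polynomial\<close>

definition r_max :: "'a set_system \<Rightarrow> nat" where
  "r_max D = Max (card ` feasible D)"

definition xi :: "'a set_system \<Rightarrow> 'a set \<Rightarrow> rat" where
  "xi D A = (of_nat (card A) + of_nat (r_max (loop_compl_set D A)) - of_nat (r_max D)) / 2"

text \<open>The exponents \<open>xi D A\<close> are half-integers.  \<open>half_pow x s r\<close> is \<open>x\<close> to the power \<open>r\<close> for a
  half-integer \<open>r\<close>, where \<open>s\<close> is a chosen square root of \<open>x\<close>.\<close>
definition half_pow :: "'k::field_char_0 \<Rightarrow> 'k \<Rightarrow> rat \<Rightarrow> 'k" where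
  "half_pow x s r = (if r \<in> \<int> then x powi \<lfloor>r\<rfloor> else x powi \<lfloor>r\<rfloor> * s)"

text \<open>\<open>s\<close> and \<open>t\<close> are the square roots of \<open>x - 1\<close> and \<open>y - 1\<close> with respect to which the
  half-integral powers are taken.\<close>
definition P_tilde :: "'a set_system \<Rightarrow> 'k::field_char_0 \<Rightarrow> 'k \<Rightarrow> 'k \<Rightarrow> 'k \<Rightarrow> 'k" where
  "P_tilde D x s y t = (\<Sum>A\<in>Pow (ground D).
     half_pow (x - 1) s (xi D (ground D) - xi D A) * half_pow (y - 1) t (of_nat (card A) - xi D A))"

end

theory Submission
  imports Defs
begin

text \<open>The gap \<open>r_max (D + A) - r_max D\<close> is additive along the coproduct. For a delta-matroid, contracting \<open>A\<close>
  keeps the feasible sets meeting \<open>A\<close> in the maximal number \<open>rho D A\<close> of elements, and every feasible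
  set extends to one of maximal cardinality, so \<open>r_max (D / A) = r_max D - rho D A\<close>. Loop
  complementation away from \<open>A\<close> commutes with contracting \<open>A\<close> and leaves \<open>rho D A\<close> unchanged. Hence
  \<open>xi (D / (E - A)) = xi D A\<close> and \<open>xi ((D + A) / A) = xi D E - xi D A\<close>. Since \<open>delta\<close> agrees on one-element
  delta-matroids with \<open>weight\<close>, the monomial with exponents \<open>xi\<close> and \<open>card E - xi\<close>, each of the
  \<open>k!\<close> orderings of a \<open>k\<close>-element ground set contributes the same monomial to the \<open>k\<close>-th convolution
  power, so the convolution exponential of \<open>delta\<close> is \<open>weight\<close>; the theorem is then a comparison
  of monomials.\<close>

section \<open>Loop complementation and vf-safety\<close>

lemma feasible_loop_compl_iff:
  "G \<in> feasible (loop_compl D e) \<longleftrightarrow> (G \<in> feasible D) \<noteq> (e \<in> G \<and> G - {e} \<in> feasible D)"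
proof -
  have "G \<in> {insert e F | F. F \<in> feasible D \<and> e \<notin> F} \<longleftrightarrow> e \<in> G \<and> G - {e} \<in> feasible D"
    by (auto simp: insert_absorb intro!: exI[of _ "G - {e}"])
  then show ?thesis
    by (auto simp: loop_compl_def)
qed

lemma ground_loop_compl [simp]: "ground (loop_compl D e) = ground D"
  by (simp add: loop_compl_def)

lemma ground_twist [simp]: "ground (twist D A) = ground D"
  by (simp add: twist_def)

lemma set_system_eqI: "ground D = ground D' \<Longrightarrow> feasible D = feasible D' \<Longrightarrow> D = D'"
  by (simp add: prod_eq_iff)

text \<open>For \<open>a \<noteq> b\<close>, membership of \<open>G\<close> on either side is the
  parity of the number of feasible sets among those obtained from \<open>G\<close> by removing some
  of the elements of \<open>{a, b}\<close> that lie in \<open>G\<close>. This count is symmetric in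
  \<open>a\<close> and \<open>b\<close>.\<close>

lemma loop_compl_commute: "loop_compl (loop_compl D a) b = loop_compl (loop_compl D b) a"
proof (cases "a = b")
  case False
  show ?thesis
  proof (rule set_system_eqI)
    have "G - {a} - {b} = G - {b} - {a}" for G by auto
    with False show "feasible (loop_compl (loop_compl D a) b) = feasible (loop_compl (loop_compl D b) a)"
      by (intro set_eqI) (simp add: feasible_loop_compl_iff, metis)
  qed simp
qed simp

interpretation loop_compl: comp_fun_commute "\<lambda>e D. loop_compl D e"
  by standard (simp add: fun_eq_iff loop_compl_commute)

lemma loop_compl_set_empty [simp]: "loop_compl_set D {} = D"
  by (simp add: loop_compl_set_def)

lemma loop_compl_set_insert:
  "finite A \<Longrightarrow> x \<notin> A \<Longrightarrow> loop_compl_set D (insert x A) = loop_compl (loop_compl_set D A) x"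
  by (simp add: loop_compl_set_def)

lemma loop_compl_set_singleton [simp]: "loop_compl_set D {x} = loop_compl D x"
  by (simp add: loop_compl_set_insert)

lemma ground_loop_compl_set [simp]: "finite A \<Longrightarrow> ground (loop_compl_set D A) = ground D"
  by (induction A rule: finite_induct) (simp_all add: loop_compl_set_insert)

lemma loop_compl_set_union:
  assumes "finite A" "finite B" "A \<inter> B = {}"
  shows "loop_compl_set (loop_compl_set D A) B = loop_compl_set D (A \<union> B)"
  using assms(2,3)
  by (induction B rule: finite_induct) (simp_all add: loop_compl_set_insert assms(1))

lemma vf_reachable_trans:
  assumes "vf_reachable D' D''" "vf_reachable D D'"
  shows "vf_reachable D D''"
  using assms by induction (auto intro: vf_reachable.intros)

lemma vf_safe_reachable: "vf_safe D \<Longrightarrow> vf_reachable D D' \<Longrightarrow> vf_safe D'"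
  unfolding vf_safe_def using vf_reachable_trans by blast

lemma vf_safe_imp_delta_matroid: "vf_safe D \<Longrightarrow> delta_matroid D"
  unfolding vf_safe_def using vf_reachable.refl by blast

lemma vf_safe_loop_compl: "vf_safe D \<Longrightarrow> e \<in> ground D \<Longrightarrow> vf_safe (loop_compl D e)"
  by (meson vf_safe_reachable vf_reachable.intros)

lemma vf_safe_loop_compl_set:
  assumes "vf_safe D" "finite A" "A \<subseteq> ground D"
  shows "vf_safe (loop_compl_set D A)"
  using assms(2,3)
  by (induction A rule: finite_induct)
     (simp_all add: loop_compl_set_insert assms(1) vf_safe_loop_compl)

section \<open>Contraction\<close>

lemma delta_matroid_finite: "delta_matroid D \<Longrightarrow> finite (ground D)"
  and delta_matroid_nonempty: "delta_matroid D \<Longrightarrow> feasible D \<noteq> {}"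
  and delta_matroid_subset: "delta_matroid D \<Longrightarrow> F \<in> feasible D \<Longrightarrow> F \<subseteq> ground D"
  by (simp_all add: delta_matroid_def)

lemma delta_matroid_finite_feasible: "delta_matroid D \<Longrightarrow> finite (feasible D)"
  by (meson delta_matroid_finite delta_matroid_subset finite_Pow_iff finite_subset PowI subsetI)

lemma delta_matroid_finite_set: "delta_matroid D \<Longrightarrow> F \<in> feasible D \<Longrightarrow> finite F"
  by (meson delta_matroid_finite delta_matroid_subset finite_subset)

lemma delta_matroid_exchange:
  assumes "delta_matroid D" "X \<in> feasible D" "Y \<in> feasible D" "u \<in> sym_diff X Y"
  obtains v where "v \<in> sym_diff X Y" "sym_diff X {u, v} \<in> feasible D"
  using assms unfolding delta_matroid_def by blast

text \<open>For a delta-matroid this is the rank of \<open>A\<close> in the upper matroid, whose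
  bases are the feasible sets of maximal cardinality: by \<open>feasible_extend_to_r_max\<close> the
  maximum is attained at one of them.\<close>

definition rho :: "'a set_system \<Rightarrow> 'a set \<Rightarrow> nat" where
  "rho D A = Max ((\<lambda>F. card (F \<inter> A)) ` feasible D)"

lemma card_le_rho: "delta_matroid D \<Longrightarrow> F \<in> feasible D \<Longrightarrow> card (F \<inter> A) \<le> rho D A"
  unfolding rho_def by (intro Max_ge) (auto simp: delta_matroid_finite_feasible)

lemma rho_attained:
  assumes "delta_matroid D"
  obtains F where "F \<in> feasible D" "card (F \<inter> A) = rho D A"
proof -
  have "rho D A \<in> (\<lambda>F. card (F \<inter> A)) ` feasible D"
    unfolding rho_def
    by (intro Max_in) (auto simp: delta_matroid_finite_feasible delta_matroid_nonempty assms)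
  then show ?thesis using that by auto
qed

lemma rho_eqI:
  assumes "delta_matroid D" "F \<in> feasible D" "card (F \<inter> A) = n"
    and "\<And>G. G \<in> feasible D \<Longrightarrow> card (G \<inter> A) \<le> n"
  shows "rho D A = n"
  unfolding rho_def using assms by (intro Max_eqI) (auto simp: delta_matroid_finite_feasible)

lemma card_le_r_max: "delta_matroid D \<Longrightarrow> F \<in> feasible D \<Longrightarrow> card F \<le> r_max D"
  unfolding r_max_def by (intro Max_ge) (auto simp: delta_matroid_finite_feasible)

lemma r_max_attained:
  assumes "delta_matroid D"
  obtains F where "F \<in> feasible D" "card F = r_max D"
proof -
  have "r_max D \<in> card ` feasible D"
    unfolding r_max_def
    by (intro Max_in) (auto simp: delta_matroid_finite_feasible delta_matroid_nonempty assms)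
  then show ?thesis using that by auto
qed

lemma r_max_le_card_ground: "delta_matroid D \<Longrightarrow> r_max D \<le> card (ground D)"
  by (metis card_mono delta_matroid_finite delta_matroid_subset r_max_attained)

text \<open>The trace of \<open>X\<close> on \<open>A\<close> is moved to that of \<open>Y\<close>
  one exchange at a time. Since \<open>X\<close> already meets \<open>A\<close> in the maximal
  number of elements, bringing in some \<open>u\<close> from \<open>A\<close> must remove some
  \<open>v\<close> from \<open>A\<close>, so the part outside \<open>A\<close> never
  changes.\<close>

lemma feasible_replace_max_trace:
  assumes D: "delta_matroid D" and Y: "Y \<in> feasible D" "card (Y \<inter> A) = rho D A"
    and X: "X \<in> feasible D" "card (X \<inter> A) = rho D A"
  shows "(X - A) \<union> (Y \<inter> A) \<in> feasible D"
  using X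
proof (induction "card ((Y - X) \<inter> A)" arbitrary: X rule: less_induct)
  case less
  note finX = delta_matroid_finite_set[OF D less.prems(1)]
  note finY = delta_matroid_finite_set[OF D Y(1)]
  show ?case
  proof (cases "Y \<inter> A \<subseteq> X")
    case True
    then have "Y \<inter> A = X \<inter> A"
      using less.prems(2) Y(2) finX by (intro card_subset_eq) auto
    then have "(X - A) \<union> (Y \<inter> A) = X" by auto
    then show ?thesis using less.prems by simp
  next
    case False
    then obtain u where u: "u \<in> Y" "u \<in> A" "u \<notin> X" by auto
    then obtain v where v: "v \<in> sym_diff X Y" and X': "sym_diff X {u, v} \<in> feasible D"
      using delta_matroid_exchange[OF D less.prems(1) Y(1)] by blast
    \<comment> \<open>Otherwise the exchange would enlarge the trace on \<open>A\<close> beyond \<open>rho D A\<close>.\<close>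
    have vX: "v \<in> X \<inter> A"
    proof (rule ccontr)
      assume "v \<notin> X \<inter> A"
      then have "insert u (X \<inter> A) \<subseteq> sym_diff X {u, v} \<inter> A" using u by auto
      then have "card (insert u (X \<inter> A)) \<le> card (sym_diff X {u, v} \<inter> A)"
        using finX by (intro card_mono) auto
      also have "\<dots> \<le> rho D A" using card_le_rho[OF D X'] .
      finally show False using u finX less.prems(2) by simp
    qed
    have eq: "sym_diff X {u, v} = insert u (X - {v})" using u vX by auto
    have "insert u (X - {v}) \<inter> A = insert u (X \<inter> A - {v})" using u by auto
    then have card: "card (insert u (X - {v}) \<inter> A) = rho D A"
      using finX u vX less.prems(2) card_Suc_Diff1[of "X \<inter> A" v]
      by (simp del: card_Diff_singleton Int_insert_left)
    \<comment> \<open>The difference loses \<open>u\<close>, and \<open>v\<close> does not enter it: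
      \<open>v\<close> lies in \<open>X\<close> and in the symmetric difference, hence not in
      \<open>Y\<close>.\<close>
    have "card ((Y - insert u (X - {v})) \<inter> A) < card ((Y - X) \<inter> A)"
      using finY u v vX by (intro psubset_card_mono) auto
    from less.hyps[OF this X'[unfolded eq] card]
    have "(insert u (X - {v}) - A) \<union> (Y \<inter> A) \<in> feasible D" .
    moreover have "insert u (X - {v}) - A = X - A" using u vX by auto
    ultimately show ?thesis by simp
  qed
qed

text \<open>Starting from any feasible set \<open>Y\<close> of maximal cardinality, each exchange
  towards \<open>X\<close> brings in an element of \<open>X\<close> and must remove one outside
  \<open>X\<close>. The cardinality stays maximal while \<open>X - Y\<close> shrinks.\<close>

lemma feasible_extend_to_r_max:
  assumes D: "delta_matroid D" and X: "X \<in> feasible D"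
  obtains Y where "Y \<in> feasible D" "card Y = r_max D" "X \<subseteq> Y"
proof -
  have "\<exists>Z\<in>feasible D. card Z = r_max D \<and> X \<subseteq> Z"
    if "Y \<in> feasible D" "card Y = r_max D" for Y
    using that
  proof (induction "card (X - Y)" arbitrary: Y rule: less_induct)
    case less
    note finY = delta_matroid_finite_set[OF D less.prems(1)]
    note finX = delta_matroid_finite_set[OF D X]
    show ?case
    proof (cases "X \<subseteq> Y")
      case False
      then obtain u where u: "u \<in> X" "u \<notin> Y" by auto
      then obtain v where v: "v \<in> sym_diff Y X" and Y': "sym_diff Y {u, v} \<in> feasible D"
        using delta_matroid_exchange[OF D less.prems(1) X] by blast
      \<comment> \<open>The possibility \<open>v = u\<close> is excluded too: it would make
        \<open>insert u Y\<close> feasible.\<close>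
      have vY: "v \<in> Y"
      proof (rule ccontr)
        assume "v \<notin> Y"
        then have "insert u Y \<subseteq> sym_diff Y {u, v}" using u by auto
        then have "card (insert u Y) \<le> card (sym_diff Y {u, v})"
          using finY by (intro card_mono) auto
        also have "\<dots> \<le> r_max D" using card_le_r_max[OF D Y'] .
        finally show False using u finY less.prems(2) by simp
      qed
      have eq: "sym_diff Y {u, v} = insert u (Y - {v})" using u vY by auto
      have card: "card (insert u (Y - {v})) = r_max D"
        using finY u vY less.prems(2) card_Suc_Diff1[of Y v] by (simp del: card_Diff_singleton)
      have "card (X - insert u (Y - {v})) < card (X - Y)"
        using finX u v vY by (intro psubset_card_mono) auto
      from less.hyps[OF this Y'[unfolded eq] card] show ?thesis .
    qed (use less.prems in blast)
  qed
  then show ?thesis using that r_max_attained[OF D] by metis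
qed

text \<open>The closed form of \<open>contract_set\<close>. It does not mention an order on \<open>A\<close>, which settles that the
  contractions commute on delta-matroids; on arbitrary set systems they do not.\<close>
definition contract_max :: "'a set_system \<Rightarrow> 'a set \<Rightarrow> 'a set_system" where
  "contract_max D A = (ground D - A, {F - A | F. F \<in> feasible D \<and> card (F \<inter> A) = rho D A})"

text \<open>If some feasible set with maximal trace on \<open>A\<close> contains \<open>x\<close>,
  then \<open>x\<close> is not a loop after contracting \<open>A\<close>, \<open>rho\<close> grows
  by one, and the maximum on \<open>insert x A\<close> is attained exactly by such sets. Otherwise
  \<open>x\<close> has become a loop and \<open>rho\<close> stays the same; more feasible sets may
  then attain the maximum, but they leave no new remainders.\<close>

lemma contract_contract_max:
  assumes D: "delta_matroid D" and x: "x \<in> ground D" "x \<notin> A" and A: "finite A"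
  shows "contract (contract_max D A) x = contract_max D (insert x A)"
proof (cases "\<exists>F\<in>feasible D. card (F \<inter> A) = rho D A \<and> x \<in> F")
  case True
  then obtain F where F: "F \<in> feasible D" "card (F \<inter> A) = rho D A" "x \<in> F" by blast
  have card_insert: "card (G \<inter> insert x A) = card (G \<inter> A) + (if x \<in> G then 1 else 0)" for G
    using A x by simp
  have rho: "rho D (insert x A) = rho D A + 1"
    using F A x(2) card_le_rho[OF D] by (intro rho_eqI[OF D F(1)]) (auto simp: card_insert le_SucI)
  have loop: "\<not> is_loop (contract_max D A) x"
    using F x unfolding is_loop_def contract_max_def by auto
  have "card (G \<inter> insert x A) = rho D A + 1 \<longleftrightarrow> card (G \<inter> A) = rho D A \<and> x \<in> G"
    if "G \<in> feasible D" for G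
    using card_le_rho[OF D that, of A] by (auto simp: card_insert)
  then have "contract_max D (insert x A) =
      (ground D - insert x A, {G - insert x A | G. G \<in> feasible D \<and> card (G \<inter> A) = rho D A \<and> x \<in> G})"
    unfolding contract_max_def rho by (auto simp del: One_nat_def)
  moreover have "contract (contract_max D A) x =
      (ground D - insert x A, {G - insert x A | G. G \<in> feasible D \<and> card (G \<inter> A) = rho D A \<and> x \<in> G})"
  proof -
    have "G - A - {x} = G - insert x A" for G by auto
    then show ?thesis
      using loop x(2) unfolding contract_def contract_max_def by auto
  qed
  ultimately show ?thesis by simp
next
  case False
  obtain F where F: "F \<in> feasible D" "card (F \<inter> A) = rho D A"
    using rho_attained[OF D] .
  have xF: "x \<notin> G" if "G \<in> feasible D" "card (G \<inter> A) = rho D A" for G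
    using False that by blast
  have card_insert: "card (G \<inter> insert x A) = card (G \<inter> A) + (if x \<in> G then 1 else 0)" for G
    using A x by simp
  have rho: "rho D (insert x A) = rho D A"
  proof (rule rho_eqI[OF D F(1)])
    show "card (G \<inter> insert x A) \<le> rho D A" if "G \<in> feasible D" for G
      using xF[OF that] card_le_rho[OF D that, of A] unfolding card_insert
      by (cases "x \<in> G"; cases "card (G \<inter> A) = rho D A") auto
  qed (use F xF in \<open>auto simp: card_insert\<close>)
  have loop: "is_loop (contract_max D A) x"
    using xF x unfolding is_loop_def contract_max_def by auto
  \<comment> \<open>Such a \<open>G\<close> may contain \<open>x\<close> and fall one short of the
    maximum on \<open>A\<close>. Replacing its trace on \<open>insert x A\<close> by that of
    \<open>F\<close> repairs this and keeps the remainder.\<close>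
  have replace: "\<exists>H. G - insert x A = H - A \<and> H \<in> feasible D \<and> card (H \<inter> A) = rho D A"
    if G: "G \<in> feasible D" "card (G \<inter> insert x A) = rho D A" for G
  proof -
    have "(G - insert x A) \<union> (F \<inter> insert x A) \<in> feasible D"
      using G F xF by (intro feasible_replace_max_trace[OF D]) (auto simp: rho card_insert)
    moreover have "((G - insert x A) \<union> (F \<inter> insert x A)) \<inter> A = F \<inter> A" by auto
    moreover have "((G - insert x A) \<union> (F \<inter> insert x A)) - A = G - insert x A"
      using xF[OF F] by auto
    ultimately show ?thesis using F by metis
  qed
  have same: "G - A = G - insert x A" "card (G \<inter> insert x A) = rho D A"
    if "G \<in> feasible D" "card (G \<inter> A) = rho D A" for G
    using xF[OF that] that by (auto simp: card_insert)
  have "{G - insert x A | G. G \<in> feasible D \<and> card (G \<inter> insert x A) = rho D A} =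
     {G - A | G. G \<in> feasible D \<and> card (G \<inter> A) = rho D A}"
  proof (intro equalityI subsetI; elim CollectE exE conjE)
    fix T G
    assume "T = G - insert x A" "G \<in> feasible D" "card (G \<inter> insert x A) = rho D A"
    with replace[of G] show "T \<in> {G - A | G. G \<in> feasible D \<and> card (G \<inter> A) = rho D A}"
      by simp
  next
    fix T G
    assume "T = G - A" and G: "G \<in> feasible D" "card (G \<inter> A) = rho D A"
    with same[OF G] show "T \<in> {G - insert x A | G. G \<in> feasible D \<and> card (G \<inter> insert x A) = rho D A}"
      by blast
  qed
  then show ?thesis
    using loop xF unfolding contract_def contract_max_def rho by auto
qed

text \<open>The fold laws for commuting functions do not apply, as contractions commute only on
  delta-matroids. Instead, induction over \<open>fold_graph\<close> shows that every order of
  contraction ends in the closed form, so the description in the definition of the fold has a unique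
  value.\<close>

lemma contract_set_eq_contract_max:
  assumes D: "delta_matroid D" and A: "finite A" "A \<subseteq> ground D"
  shows "contract_set D A = contract_max D A"
proof -
  have unique: "E = contract_max D B"
    if "fold_graph (\<lambda>e D. contract D e) D B E" "B \<subseteq> ground D" for B E
    using that
  proof induction
    case emptyI
    have "rho D {} = 0"
      using delta_matroid_nonempty[OF D] by (simp add: rho_def image_constant_conv)
    then show ?case by (simp add: contract_max_def)
  next
    case (insertI x B E)
    have sub: "x \<in> ground D" "B \<subseteq> ground D" using insertI.prems by auto
    then have "finite B" using delta_matroid_finite[OF D] finite_subset by blast
    with sub insertI.hyps insertI.IH show ?case
      by (simp add: contract_contract_max[OF D])
  qed
  obtain E where E: "fold_graph (\<lambda>e D. contract D e) D A E"
    using finite_imp_fold_graph[OF A(1), of "\<lambda>e D. contract D e" D] by (elim exE)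
  have "(THE E. fold_graph (\<lambda>e D. contract D e) D A E) = contract_max D A"
  proof (rule the_equality)
    show "fold_graph (\<lambda>e D. contract D e) D A (contract_max D A)"
      using E unique[OF E A(2)] by simp
  qed (rule unique[OF _ A(2)])
  then show ?thesis
    by (simp add: contract_set_def Finite_Set.fold_def A(1))
qed

lemma contract_set_empty [simp]: "contract_set D {} = D"
  by (simp add: contract_set_def)

lemma contract_set_insert:
  assumes "delta_matroid D" "finite A" "insert x A \<subseteq> ground D" "x \<notin> A"
  shows "contract_set D (insert x A) = contract (contract_set D A) x"
  using assms by (simp add: contract_set_eq_contract_max contract_contract_max)

lemma ground_contract [simp]: "ground (contract D x) = ground D - {x}"
  by (simp add: contract_def)

lemma ground_contract_set:
  "delta_matroid D \<Longrightarrow> finite A \<Longrightarrow> A \<subseteq> ground D \<Longrightarrow> ground (contract_set D A) = ground D - A"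
  by (simp add: contract_set_eq_contract_max contract_max_def)

text \<open>A feasible set attaining \<open>rho D A\<close> extends to one of maximal cardinality,
  which still attains \<open>rho D A\<close>. Thus both maxima occur at a single set
  \<open>G\<close>, and \<open>G - A\<close> is a largest feasible set of the contraction.\<close>

lemma r_max_contract_set:
  assumes D: "delta_matroid D" and A: "finite A" "A \<subseteq> ground D"
  shows "r_max (contract_set D A) + rho D A = r_max D"
proof -
  obtain F where F: "F \<in> feasible D" "card (F \<inter> A) = rho D A"
    using rho_attained[OF D] .
  obtain G where G: "G \<in> feasible D" "card G = r_max D" "F \<subseteq> G"
    using feasible_extend_to_r_max[OF D F(1)] .
  have "card (F \<inter> A) \<le> card (G \<inter> A)"
    using G by (intro card_mono) (auto simp: delta_matroid_finite_set[OF D])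
  then have GA: "card (G \<inter> A) = rho D A"
    using F card_le_rho[OF D G(1), of A] by simp
  have diff: "card (H - A) + rho D A = card H"
    if "H \<in> feasible D" "card (H \<inter> A) = rho D A" for H
    using card_Diff_subset_Int[of H A] that card_mono[of H "H \<inter> A"] delta_matroid_finite_set[OF D]
    by auto
  have "r_max (contract_set D A) = card (G - A)"
    unfolding r_max_def contract_set_eq_contract_max[OF D A] contract_max_def
  proof (rule Max_eqI)
    have "snd (ground D - A, {F - A |F. F \<in> feasible D \<and> card (F \<inter> A) = rho D A})
        \<subseteq> (\<lambda>F. F - A) ` feasible D" by auto
    then show "finite (card ` snd (ground D - A, {F - A |F. F \<in> feasible D \<and> card (F \<inter> A) = rho D A}))"
      using delta_matroid_finite_feasible[OF D] by (meson finite_imageI finite_subset)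
    show "y \<le> card (G - A)"
      if y: "y \<in> card ` snd (ground D - A, {F - A |F. F \<in> feasible D \<and> card (F \<inter> A) = rho D A})" for y
    proof -
      obtain H where H: "H \<in> feasible D" "card (H \<inter> A) = rho D A" "y = card (H - A)"
        using y by auto
      then show ?thesis
        using diff[OF H(1,2)] diff[OF G(1) GA] G(2) card_le_r_max[OF D H(1)] by simp
    qed
    show "card (G - A) \<in> card ` snd (ground D - A, {F - A |F. F \<in> feasible D \<and> card (F \<inter> A) = rho D A})"
      using G GA by auto
  qed
  then show ?thesis using diff[OF G(1) GA] G(2) by simp
qed

section \<open>Contraction of an element against operations away from it\<close>

lemma traces_loop_compl:
  assumes "e \<notin> A"
  shows "(\<lambda>F. F \<inter> A) ` feasible (loop_compl D e) = (\<lambda>F. F \<inter> A) ` feasible D"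
proof (intro equalityI subsetI; elim imageE)
  fix T F
  assume T: "T = F \<inter> A" and F: "F \<in> feasible (loop_compl D e)"
  have "T = (F - {e}) \<inter> A" using T assms by auto
  then show "T \<in> (\<lambda>F. F \<inter> A) ` feasible D"
    using T F by (cases "F \<in> feasible D") (auto simp: feasible_loop_compl_iff)
next
  fix T F
  assume T: "T = F \<inter> A" and F: "F \<in> feasible D"
  have "T = (F - {e}) \<inter> A" using T assms by auto
  \<comment> \<open>If \<open>F\<close> is cancelled, then \<open>F - {e}\<close> was feasible, and
    a feasible set without \<open>e\<close> is never cancelled.\<close>
  moreover have "F \<in> feasible (loop_compl D e) \<or> F - {e} \<in> feasible (loop_compl D e)"
    using F by (auto simp: feasible_loop_compl_iff)
  ultimately show "T \<in> (\<lambda>F. F \<inter> A) ` feasible (loop_compl D e)"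
    using T by blast
qed

lemma is_loop_loop_compl:
  assumes "x \<noteq> e"
  shows "is_loop (loop_compl D e) x \<longleftrightarrow> is_loop D x"
proof -
  \<comment> \<open>Being a loop is visible in the traces on \<open>{x}\<close>, which
    complementation at \<open>e\<close> preserves.\<close>
  have "is_loop D' x \<longleftrightarrow> x \<in> ground D' \<and> {x} \<notin> (\<lambda>F. F \<inter> {x}) ` feasible D'" for D'
    unfolding is_loop_def by auto
  then show ?thesis using assms by (simp add: traces_loop_compl)
qed

text \<open>The contraction (\<open>b\<close> true) or deletion (\<open>b\<close> false) of \<open>x\<close> without the convention for loops, so that
  it commutes with twists and loop complementations away from \<open>x\<close> unconditionally.\<close>
definition slice :: "bool \<Rightarrow> 'a \<Rightarrow> 'a set_system \<Rightarrow> 'a set_system" where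
  "slice b x D = (ground D - {x}, {F - {x} | F. F \<in> feasible D \<and> (x \<in> F \<longleftrightarrow> b)})"

lemma ground_slice [simp]: "ground (slice b x D) = ground D - {x}"
  by (simp add: slice_def)

lemma feasible_slice_iff:
  "G \<in> feasible (slice b x D) \<longleftrightarrow> x \<notin> G \<and> (if b then insert x G else G) \<in> feasible D"
proof -
  have "G \<in> feasible (slice b x D) \<longleftrightarrow> (\<exists>F. G = F - {x} \<and> F \<in> feasible D \<and> (x \<in> F \<longleftrightarrow> b))"
    by (auto simp: slice_def)
  also have "\<dots> \<longleftrightarrow> x \<notin> G \<and> (if b then insert x G else G) \<in> feasible D"
  proof
    assume "x \<notin> G \<and> (if b then insert x G else G) \<in> feasible D"
    then show "\<exists>F. G = F - {x} \<and> F \<in> feasible D \<and> (x \<in> F \<longleftrightarrow> b)"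
      by (intro exI[of _ "if b then insert x G else G"]) simp
  qed (cases b; force simp: insert_absorb)
  finally show ?thesis .
qed

lemma contract_eq_slice: "x \<in> ground D \<Longrightarrow> contract D x = slice (\<not> is_loop D x) x D"
  by (intro set_system_eqI) (auto simp: contract_def slice_def is_loop_def)

lemma loop_compl_slice: "x \<noteq> e \<Longrightarrow> loop_compl (slice b x D) e = slice b x (loop_compl D e)"
proof (intro set_system_eqI set_eqI)
  fix G
  assume "x \<noteq> e"
  then have "insert x (G - {e}) = insert x G - {e}" by auto
  then show "G \<in> feasible (loop_compl (slice b x D) e) \<longleftrightarrow> G \<in> feasible (slice b x (loop_compl D e))"
    using \<open>x \<noteq> e\<close> by (auto simp: feasible_loop_compl_iff feasible_slice_iff)
qed simp

lemma feasible_twist_iff: "G \<in> feasible (twist D A) \<longleftrightarrow> sym_diff A G \<in> feasible D"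
proof
  assume "sym_diff A G \<in> feasible D"
  moreover have "G = sym_diff A (sym_diff A G)" by auto
  ultimately show "G \<in> feasible (twist D A)" unfolding twist_def by (auto intro!: image_eqI)
next
  assume "G \<in> feasible (twist D A)"
  then obtain F where F: "F \<in> feasible D" "G = sym_diff A F" unfolding twist_def by auto
  moreover have "sym_diff A (sym_diff A F) = F" by auto
  ultimately show "sym_diff A G \<in> feasible D" by simp
qed

lemma twist_slice: "x \<notin> A \<Longrightarrow> twist (slice b x D) A = slice b x (twist D A)"
proof (intro set_system_eqI set_eqI)
  fix G
  assume "x \<notin> A"
  then have "sym_diff A (insert x G) = insert x (sym_diff A G)" by auto
  then show "G \<in> feasible (twist (slice b x D) A) \<longleftrightarrow> G \<in> feasible (slice b x (twist D A))"
    using \<open>x \<notin> A\<close> by (auto simp: feasible_twist_iff feasible_slice_iff)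
qed simp

lemma feasible_loop_compl_nonempty: "feasible D \<noteq> {} \<Longrightarrow> feasible (loop_compl D e) \<noteq> {}"
  using feasible_loop_compl_iff[of _ D e] by (metis Diff_iff empty_iff ex_in_conv singletonI)

lemma vf_reachable_nonempty:
  assumes "vf_reachable D D'" "feasible D \<noteq> {}"
  shows "feasible D' \<noteq> {}"
  using assms by induction (auto simp: feasible_loop_compl_nonempty, auto simp: twist_def)

text \<open>Restoring the prescribed state of \<open>x\<close> by \<open>h\<close> leaves symmetric
  differences unchanged. An exchange in \<open>D\<close> therefore never touches \<open>x\<close>
  and descends to the slice.\<close>

lemma delta_matroid_slice:
  assumes D: "delta_matroid D" and ne: "feasible (slice b x D) \<noteq> {}"
  shows "delta_matroid (slice b x D)"
proof -
  define h where "h G = (if b then insert x G else G)" for G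
  have mem: "G \<in> feasible (slice b x D) \<longleftrightarrow> x \<notin> G \<and> h G \<in> feasible D" for G
    by (simp add: feasible_slice_iff h_def)
  have "\<exists>v\<in>sym_diff X Y. sym_diff X {u, v} \<in> feasible (slice b x D)"
    if X: "X \<in> feasible (slice b x D)" and Y: "Y \<in> feasible (slice b x D)" and u: "u \<in> sym_diff X Y"
    for X Y u
  proof -
    have x: "x \<notin> X" "x \<notin> Y" and h: "h X \<in> feasible D" "h Y \<in> feasible D"
      using X Y unfolding mem by auto
    have sd: "sym_diff (h X) (h Y) = sym_diff X Y"
      using x by (auto simp: h_def)
    with u obtain v where v: "v \<in> sym_diff X Y" "sym_diff (h X) {u, v} \<in> feasible D"
      using delta_matroid_exchange[OF D h] by metis
    have "sym_diff (h X) {u, v} = h (sym_diff X {u, v})" "x \<notin> sym_diff X {u, v}"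
      using x u v(1) by (auto simp: h_def)
    with v(2) have "sym_diff X {u, v} \<in> feasible (slice b x D)"
      unfolding mem by metis
    with v(1) show ?thesis by (rule rev_bexI)
  qed
  moreover have "finite (ground (slice b x D))" by (simp add: delta_matroid_finite[OF D])
  moreover have "F \<subseteq> ground (slice b x D)" if "F \<in> feasible (slice b x D)" for F
    using that delta_matroid_subset[OF D] by (force simp: slice_def)
  ultimately show ?thesis
    using ne by (simp add: delta_matroid_def)
qed

text \<open>Operations on the slice avoid \<open>x\<close>, hence lift to \<open>D\<close>:
  everything reachable from the slice is the slice of something reachable from \<open>D\<close>.
  Nonemptiness, which \<open>delta_matroid_slice\<close> requires, is inherited along the
  way.\<close>

lemma vf_safe_slice:
  assumes D: "vf_safe D" and ne: "feasible (slice b x D) \<noteq> {}"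
  shows "vf_safe (slice b x D)"
  unfolding vf_safe_def
proof (intro allI impI)
  fix D'
  assume reach: "vf_reachable (slice b x D) D'"
  then have "\<exists>D''. vf_reachable D D'' \<and> D' = slice b x D''"
  proof induction
    case refl
    then show ?case using vf_reachable.refl by blast
  next
    case (twist D' A)
    then obtain D'' where D'': "vf_reachable D D''" "D' = slice b x D''" by blast
    moreover have A: "A \<subseteq> ground D''" "x \<notin> A" using twist.hyps(2) D'' by auto
    ultimately show ?case
      using twist_slice[OF A(2)] vf_reachable.twist[OF D''(1) A(1)] by blast
  next
    case (loop_compl D' e)
    then obtain D'' where D'': "vf_reachable D D''" "D' = slice b x D''" by blast
    moreover have e: "e \<in> ground D''" "x \<noteq> e" using loop_compl.hyps(2) D'' by auto
    ultimately show ?case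
      using loop_compl_slice[OF e(2)] vf_reachable.loop_compl[OF D''(1) e(1)] by blast
  qed
  then obtain D'' where D'': "vf_reachable D D''" "D' = slice b x D''" by blast
  have "delta_matroid D''"
    using vf_safe_imp_delta_matroid[OF vf_safe_reachable[OF D D''(1)]] .
  then show "delta_matroid D'"
    using vf_reachable_nonempty[OF reach ne] unfolding D''(2) by (rule delta_matroid_slice)
qed

lemma vf_safe_contract:
  assumes "vf_safe D" "x \<in> ground D"
  shows "vf_safe (contract D x)"
proof -
  have "feasible (slice (\<not> is_loop D x) x D) \<noteq> {}"
    using delta_matroid_nonempty[OF vf_safe_imp_delta_matroid[OF assms(1)]] assms(2)
    by (auto simp: slice_def is_loop_def)
  then show ?thesis
    using assms by (simp add: contract_eq_slice vf_safe_slice)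
qed

text \<open>Complementation at \<open>e\<close> does not change whether \<open>x\<close> is a loop,
  so both sides take the same slice.\<close>

lemma contract_loop_compl:
  "x \<in> ground D \<Longrightarrow> x \<noteq> e \<Longrightarrow> contract (loop_compl D e) x = loop_compl (contract D x) e"
  by (simp add: contract_eq_slice is_loop_loop_compl loop_compl_slice)

lemma vf_safe_contract_set:
  assumes D: "vf_safe D" and "finite A" "A \<subseteq> ground D"
  shows "vf_safe (contract_set D A)"
  using assms(2,3)
proof (induction A rule: finite_induct)
  case (insert x A)
  note dm = vf_safe_imp_delta_matroid[OF D]
  show ?case
    using insert by (simp add: contract_set_insert[OF dm] vf_safe_contract ground_contract_set[OF dm])
qed (simp add: D)

lemma contract_set_loop_compl:
  assumes D: "vf_safe D" and e: "e \<in> ground D" and "finite A" "A \<subseteq> ground D" "e \<notin> A"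
  shows "contract_set (loop_compl D e) A = loop_compl (contract_set D A) e"
  using assms(3-)
proof (induction A rule: finite_induct)
  case (insert x A)
  note dm = vf_safe_imp_delta_matroid[OF D] vf_safe_imp_delta_matroid[OF vf_safe_loop_compl[OF D e]]
  have x: "x \<in> ground (contract_set D A)" "x \<noteq> e"
    using insert by (auto simp: ground_contract_set[OF dm(1)])
  show ?case
    using insert
    by (simp add: contract_set_insert[OF dm(1)] contract_set_insert[OF dm(2)]
        contract_loop_compl[OF x])
qed simp

lemma contract_set_loop_compl_set:
  assumes D: "vf_safe D" and "finite B" "B \<subseteq> ground D" "A \<inter> B = {}" and A: "finite A" "A \<subseteq> ground D"
  shows "contract_set (loop_compl_set D B) A = loop_compl_set (contract_set D A) B"
  using assms(2-4)
proof (induction B rule: finite_induct)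
  case (insert x B)
  then show ?case
    by (simp add: loop_compl_set_insert contract_set_loop_compl A vf_safe_loop_compl_set D)
qed simp

lemma rho_loop_compl:
  assumes "e \<notin> A"
  shows "rho (loop_compl D e) A = rho D A"
  using arg_cong[OF traces_loop_compl[OF assms, of D], of "(`) card"]
  by (simp add: rho_def image_image)

lemma rho_loop_compl_set:
  assumes "finite B" "A \<inter> B = {}"
  shows "rho (loop_compl_set D B) A = rho D A"
  using assms by (induction B rule: finite_induct) (simp_all add: loop_compl_set_insert rho_loop_compl)

section \<open>Relabelling and isomorphism classes\<close>

definition relabel :: "('a \<Rightarrow> 'b) \<Rightarrow> 'a set_system \<Rightarrow> 'b set_system" where
  "relabel f D = (f ` ground D, (\<lambda>F. f ` F) ` feasible D)"

lemma ground_relabel [simp]: "ground (relabel f D) = f ` ground D"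
  by (simp add: relabel_def)

lemma feasible_relabel: "feasible (relabel f D) = (\<lambda>F. f ` F) ` feasible D"
  by (simp add: relabel_def)

lemma dm_iso_iff_relabel: "dm_iso D D' \<longleftrightarrow> (\<exists>f. inj_on f (ground D) \<and> D' = relabel f D)"
  by (auto simp: dm_iso_def bij_betw_def relabel_def prod_eq_iff)

lemma relabel_cong:
  assumes "delta_matroid D" "\<And>x. x \<in> ground D \<Longrightarrow> f x = g x"
  shows "relabel f D = relabel g D"
proof -
  have "f ` F = g ` F" if "F \<in> feasible D" for F
    using assms(2) delta_matroid_subset[OF assms(1) that] by (intro image_cong) auto
  then show ?thesis
    using assms(2) by (auto simp: relabel_def image_iff intro: rev_bexI)
qed

lemma relabel_relabel: "relabel g (relabel f D) = relabel (g \<circ> f) D"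
  by (simp add: relabel_def image_image image_comp)

lemma relabel_ident [simp]: "relabel (\<lambda>x. x) D = D"
  by (simp add: relabel_def)

lemma dm_iso_trans: "dm_iso D D' \<Longrightarrow> dm_iso D' D'' \<Longrightarrow> dm_iso D D''"
  unfolding dm_iso_iff_relabel by (metis comp_inj_on ground_relabel relabel_relabel)

text \<open>The inverse map undoes \<open>f\<close> only on the ground set; that \<open>D\<close> is
  a delta-matroid ensures that all feasible sets lie there.\<close>

lemma dm_iso_sym:
  assumes "delta_matroid D" "dm_iso D D'"
  shows "dm_iso D' D"
proof -
  obtain f where f: "inj_on f (ground D)" "D' = relabel f D"
    using assms(2) dm_iso_iff_relabel by metis
  have "relabel (the_inv_into (ground D) f) D' = D"
    using relabel_cong[OF assms(1), of "the_inv_into (ground D) f \<circ> f" "\<lambda>x. x"] f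
    by (simp add: relabel_relabel the_inv_into_f_f)
  moreover have "inj_on (the_inv_into (ground D) f) (ground D')"
    using f by (simp add: inj_on_the_inv_into)
  ultimately show ?thesis unfolding dm_iso_iff_relabel by metis
qed

section \<open>Transport of the operations along injective relabellings\<close>

lemma image_sym_diff:
  assumes "inj_on f E" "X \<subseteq> E" "Y \<subseteq> E"
  shows "f ` sym_diff X Y = sym_diff (f ` X) (f ` Y)"
  using assms by (simp add: image_Un inj_on_image_set_diff[of f E] Diff_subset_conv le_supI2)

context
  fixes f :: "'a \<Rightarrow> 'b" and D :: "'a set_system"
  assumes D: "delta_matroid D" and f: "inj_on f (ground D)"
begin

lemma relabel_mem_iff: "F \<in> feasible D \<Longrightarrow> x \<in> ground D \<Longrightarrow> f x \<in> f ` F \<longleftrightarrow> x \<in> F"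
  using inj_on_image_mem_iff[OF f] delta_matroid_subset[OF D] by blast

lemma delta_matroid_relabel: "delta_matroid (relabel f D)"
proof -
  have "\<exists>v\<in>sym_diff (f ` X) (f ` Y). sym_diff (f ` X) {u, v} \<in> feasible (relabel f D)"
    if X: "X \<in> feasible D" and Y: "Y \<in> feasible D" and u: "u \<in> sym_diff (f ` X) (f ` Y)" for X Y u
  proof -
    note sub = delta_matroid_subset[OF D X] delta_matroid_subset[OF D Y]
    have sd: "sym_diff (f ` X) (f ` Y) = f ` sym_diff X Y"
      using image_sym_diff[OF f sub] by simp
    then obtain u' where u': "u' \<in> sym_diff X Y" "u = f u'" using u by auto
    then obtain v where v: "v \<in> sym_diff X Y" "sym_diff X {u', v} \<in> feasible D"
      using delta_matroid_exchange[OF D X Y] by blast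
    have "sym_diff (f ` X) {u, f v} = f ` sym_diff X {u', v}"
      using image_sym_diff[OF f sub(1), of "{u', v}"] u' v(1) sub by auto
    then show ?thesis
      using v unfolding sd feasible_relabel by (intro bexI[of _ "f v"]) auto
  qed
  moreover have "f ` F \<subseteq> f ` ground D" if "F \<in> feasible D" for F
    using delta_matroid_subset[OF D that] by (rule image_mono)
  ultimately show ?thesis
    using delta_matroid_finite[OF D] delta_matroid_nonempty[OF D]
    unfolding delta_matroid_def[of "relabel f D"] feasible_relabel ground_relabel
    by (intro conjI) (simp_all add: feasible_relabel)
qed

lemma twist_relabel: "A \<subseteq> ground D \<Longrightarrow> twist (relabel f D) (f ` A) = relabel f (twist D A)"
  using delta_matroid_subset[OF D]
  by (auto simp: twist_def relabel_def image_image image_sym_diff[OF f] intro!: image_cong)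

lemma loop_compl_relabel:
  assumes "e \<in> ground D"
  shows "loop_compl (relabel f D) (f e) = relabel f (loop_compl D e)"
proof (rule set_system_eqI)
  let ?N = "{insert e F | F. F \<in> feasible D \<and> e \<notin> F}"
  \<comment> \<open>The symmetric difference here is one of families, so
    \<open>image_sym_diff\<close> is applied one level up, to the map that \<open>f\<close> induces
    on subsets.\<close>
  have "inj_on ((`) f) (Pow (ground D))"
    using f by (rule inj_on_image_Pow)
  moreover have "feasible D \<subseteq> Pow (ground D)" "?N \<subseteq> Pow (ground D)"
    using delta_matroid_subset[OF D] assms by auto
  ultimately have "(`) f ` sym_diff (feasible D) ?N = sym_diff ((`) f ` feasible D) ((`) f ` ?N)"
    by (rule image_sym_diff)
  moreover have "(`) f ` ?N = {insert (f e) G | G. G \<in> (`) f ` feasible D \<and> f e \<notin> G}"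
    using relabel_mem_iff assms by (auto simp: image_iff) blast+
  ultimately show "feasible (loop_compl (relabel f D) (f e)) = feasible (relabel f (loop_compl D e))"
    by (simp add: loop_compl_def relabel_def)
qed simp

lemma contract_relabel:
  assumes "e \<in> ground D"
  shows "contract (relabel f D) (f e) = relabel f (contract D e)"
proof -
  have mem: "f e \<in> f ` F \<longleftrightarrow> e \<in> F" if "F \<in> feasible D" for F
    using relabel_mem_iff that assms by blast
  have loop: "is_loop (relabel f D) (f e) \<longleftrightarrow> is_loop D e"
    using assms by (auto simp: is_loop_def feasible_relabel mem)
  have minus: "f ` (F - {e}) = f ` F - {f e}" if "F \<subseteq> ground D" for F
    using inj_on_image_set_diff[OF f, of F "{e}"] that assms by auto
  have "feasible (slice b (f e) (relabel f D)) = feasible (relabel f (slice b e D))" for b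
  proof -
    have "feasible (slice b (f e) (relabel f D)) =
        {f ` F - {f e} | F. F \<in> feasible D \<and> (f e \<in> f ` F \<longleftrightarrow> b)}"
      by (auto simp: slice_def feasible_relabel)
    also have "\<dots> = {f ` (F - {e}) | F. F \<in> feasible D \<and> (e \<in> F \<longleftrightarrow> b)}"
      using mem minus delta_matroid_subset[OF D] by (intro Collect_cong) metis
    also have "\<dots> = feasible (relabel f (slice b e D))"
      by (auto simp: slice_def feasible_relabel)
    finally show ?thesis .
  qed
  then have "slice b (f e) (relabel f D) = relabel f (slice b e D)" for b
    by (intro set_system_eqI) (simp_all add: minus)
  then show ?thesis
    using assms by (simp add: contract_eq_slice loop)
qed

end

text \<open>Every operation on the relabelled system lifts to \<open>D\<close>. The induction
  records that the ground set stays fixed, because \<open>f\<close> is injective only there.\<close>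

lemma vf_safe_relabel:
  assumes D: "vf_safe D" and f: "inj_on f (ground D)"
  shows "vf_safe (relabel f D)"
  unfolding vf_safe_def
proof (intro allI impI)
  fix D'
  assume "vf_reachable (relabel f D) D'"
  then have "\<exists>D''. vf_reachable D D'' \<and> ground D'' = ground D \<and> D' = relabel f D''"
  proof induction
    case refl
    then show ?case using vf_reachable.refl by blast
  next
    case (twist D' A)
    then obtain D'' where D'': "vf_reachable D D''" "ground D'' = ground D" "D' = relabel f D''"
      by blast
    then have dm: "delta_matroid D''" using D by (simp add: vf_safe_def del: split_paired_All)
    from twist.hyps(2) D''(3) obtain B where B: "B \<subseteq> ground D''" "A = f ` B"
      by (auto elim: subset_imageE)
    have "twist D' A = relabel f (twist D'' B)"
      using twist_relabel[OF dm _ B(1)] f by (simp add: D''(2,3) B(2))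
    moreover have "ground (twist D'' B) = ground D" using D''(2) by simp
    ultimately show ?case
      using vf_reachable.twist[OF D''(1) B(1)] by blast
  next
    case (loop_compl D' e)
    then obtain D'' where D'': "vf_reachable D D''" "ground D'' = ground D" "D' = relabel f D''"
      by blast
    then have dm: "delta_matroid D''" using D by (simp add: vf_safe_def del: split_paired_All)
    from loop_compl.hyps(2) D''(3) obtain x where x: "x \<in> ground D''" "e = f x"
      by auto
    have "loop_compl D' e = relabel f (loop_compl D'' x)"
      using loop_compl_relabel[OF dm _ x(1)] f by (simp add: D''(2,3) x(2))
    moreover have "ground (loop_compl D'' x) = ground D" using D''(2) by simp
    ultimately show ?case
      using vf_reachable.loop_compl[OF D''(1) x(1)] by blast
  qed
  then obtain D'' where D'': "vf_reachable D D''" "ground D'' = ground D" "D' = relabel f D''"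
    by blast
  then have "delta_matroid D''" using D by (simp add: vf_safe_def del: split_paired_All)
  then show "delta_matroid D'" using D'' f by (simp add: delta_matroid_relabel)
qed

lemma loop_compl_set_relabel:
  assumes D: "vf_safe D" and f: "inj_on f (ground D)" and "finite A" "A \<subseteq> ground D"
  shows "loop_compl_set (relabel f D) (f ` A) = relabel f (loop_compl_set D A)"
  using assms(3,4)
proof (induction A rule: finite_induct)
  case (insert x A)
  have fx: "f x \<notin> f ` A"
    using insert f by (auto dest: inj_onD)
  have dm: "delta_matroid (loop_compl_set D A)"
    using insert by (intro vf_safe_imp_delta_matroid vf_safe_loop_compl_set D) auto
  show ?case
    using insert fx loop_compl_relabel[OF dm, of f x] f by (simp add: loop_compl_set_insert)
qed simp

lemma contract_set_relabel:
  assumes D: "vf_safe D" and f: "inj_on f (ground D)" and "finite A" "A \<subseteq> ground D"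
  shows "contract_set (relabel f D) (f ` A) = relabel f (contract_set D A)"
  using assms(3,4)
proof (induction A rule: finite_induct)
  case (insert x A)
  note dmD = vf_safe_imp_delta_matroid[OF D]
  have fx: "f x \<notin> f ` A"
    using insert f by (auto dest: inj_onD)
  have dm: "delta_matroid (contract_set D A)"
    using insert by (intro vf_safe_imp_delta_matroid vf_safe_contract_set D) auto
  have ground: "ground (contract_set D A) = ground D - A"
    using insert by (intro ground_contract_set dmD) auto
  have "contract (relabel f (contract_set D A)) (f x) = relabel f (contract (contract_set D A) x)"
    using insert f by (intro contract_relabel[OF dm]) (auto simp: ground intro: inj_on_subset)
  moreover have "contract_set (relabel f D) (insert (f x) (f ` A)) =
      contract (contract_set (relabel f D) (f ` A)) (f x)"
    using insert fx by (intro contract_set_insert delta_matroid_relabel dmD f) auto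
  ultimately show ?case
    using insert by (simp add: contract_set_insert[OF dmD])
qed simp

lemma vf_safe_dm_iso: "vf_safe D \<Longrightarrow> dm_iso D D' \<Longrightarrow> vf_safe D'"
  by (auto simp: dm_iso_iff_relabel vf_safe_relabel)

lemma ex_nat_dm_iso:
  assumes "vf_safe D"
  obtains N :: "nat set_system" where "dm_iso D N" "vf_safe N"
proof -
  obtain f :: "'a \<Rightarrow> nat" where "inj_on f (ground D)"
    using finite_imp_inj_to_nat_seg[OF delta_matroid_finite[OF vf_safe_imp_delta_matroid[OF assms]]]
    by blast
  then have "dm_iso D (relabel f D)" by (auto simp: dm_iso_iff_relabel)
  with vf_safe_dm_iso[OF assms this] that show thesis by blast
qed

lemma dm_iso_vf_safe_sym: "vf_safe D \<Longrightarrow> dm_iso D D' \<Longrightarrow> dm_iso D' D"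
  by (rule dm_iso_sym[OF vf_safe_imp_delta_matroid])

text \<open>Membership in the set defining the type asks for a vf-safe system on natural numbers; an
  isomorphic copy \<open>N\<close> of \<open>D\<close> provides it and has the same isomorphic
  systems.\<close>

lemma Rep_class_of:
  assumes "vf_safe D"
  shows "Rep_dm_class (class_of D) = {D' :: nat set_system. dm_iso D D'}"
proof -
  obtain N :: "nat set_system" where N: "dm_iso D N" "vf_safe N"
    using ex_nat_dm_iso[OF assms] .
  have "{D' :: nat set_system. dm_iso D D'} = {D'. dm_iso N D'}"
    using N dm_iso_trans[OF N(1)] dm_iso_trans[OF dm_iso_vf_safe_sym[OF assms N(1)]] by auto
  then show ?thesis
    using N(2) unfolding class_of_def by (intro Abs_dm_class_inverse) blast
qed

text \<open>The two ground sets may have different types; a copy on natural numbers mediates between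
  them.\<close>

lemma class_of_eq_iff:
  assumes D: "vf_safe D" and D': "vf_safe D'"
  shows "class_of D = class_of D' \<longleftrightarrow> dm_iso D D'"
proof
  obtain N :: "nat set_system" where N: "dm_iso D N" "vf_safe N"
    using ex_nat_dm_iso[OF D] .
  assume "class_of D = class_of D'"
  then have "dm_iso D' N"
    using Rep_class_of[OF D] Rep_class_of[OF D'] N(1) by auto
  then show "dm_iso D D'"
    using dm_iso_trans[OF N(1)] dm_iso_vf_safe_sym[OF D'] by blast
next
  assume iso: "dm_iso D D'"
  have "{N :: nat set_system. dm_iso D N} = {N. dm_iso D' N}"
    using dm_iso_trans[OF iso] dm_iso_trans[OF dm_iso_vf_safe_sym[OF D iso]] by auto
  then show "class_of D = class_of D'" by (simp add: class_of_def)
qed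

lemma class_of_relabel: "vf_safe D \<Longrightarrow> inj_on f (ground D) \<Longrightarrow> class_of (relabel f D) = class_of D"
  using class_of_eq_iff[of D "relabel f D"] vf_safe_relabel dm_iso_iff_relabel by metis

lemma rep_class_of:
  assumes "vf_safe D"
  shows "dm_iso D (rep (class_of D))"
proof -
  obtain N :: "nat set_system" where "dm_iso D N"
    using ex_nat_dm_iso[OF assms] by blast
  then have "rep (class_of D) \<in> Rep_dm_class (class_of D)"
    unfolding rep_def Rep_class_of[OF assms] by (auto intro: someI)
  then show ?thesis using Rep_class_of[OF assms] by simp
qed

section \<open>Convolution\<close>

lemma mult_tensor_superset:
  assumes "finite S" "Poly_Mapping.keys w \<subseteq> S"
  shows "mult_tensor f g w = (\<Sum>p\<in>S. Poly_Mapping.lookup w p *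
     (f (Poly_Mapping.single (fst p) 1) * g (Poly_Mapping.single (snd p) 1)))"
  unfolding mult_tensor_def case_prod_beta prod.collapse
  using assms by (intro sum.mono_neutral_left) (auto simp: in_keys_iff)

text \<open>Different indices may carry the same pair of classes, so the coefficient of a pair is
  the number of its indices. Exchanging the two sums turns this count back into a sum over
  indices.\<close>

lemma mult_tensor_sum_single:
  fixes f g :: "'k::field_char_0 hpe \<Rightarrow> 'k"
  assumes "finite I"
  shows "mult_tensor f g (\<Sum>i\<in>I. Poly_Mapping.single (c i, d i) 1) =
    (\<Sum>i\<in>I. f (Poly_Mapping.single (c i) 1) * g (Poly_Mapping.single (d i) 1))"
proof -
  define S where "S = (\<lambda>i. (c i, d i)) ` I"
  define h where "h p = f (Poly_Mapping.single (fst p) 1) * g (Poly_Mapping.single (snd p) 1)" for p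
  let ?w = "\<Sum>i\<in>I. Poly_Mapping.single (c i, d i) 1 :: 'k hpe2"
  have S: "finite S" using assms by (simp add: S_def)
  have lookup: "Poly_Mapping.lookup ?w p = (\<Sum>i\<in>I. if p = (c i, d i) then 1 else 0)" for p
    by (simp add: lookup_sum lookup_single when_def eq_commute)
  have "Poly_Mapping.keys ?w \<subseteq> S"
  proof
    fix p assume "p \<in> Poly_Mapping.keys ?w"
    then have "(\<Sum>i\<in>I. if p = (c i, d i) then 1 else 0 :: 'k) \<noteq> 0"
      unfolding in_keys_iff lookup .
    then obtain i where "i \<in> I" "(if p = (c i, d i) then 1 else 0 :: 'k) \<noteq> 0"
      by (rule sum.not_neutral_contains_not_neutral)
    then show "p \<in> S" by (auto simp: S_def split: if_splits)
  qed
  then have "mult_tensor f g ?w = (\<Sum>p\<in>S. Poly_Mapping.lookup ?w p * h p)"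
    unfolding h_def by (rule mult_tensor_superset[OF S])
  also have "\<dots> = (\<Sum>p\<in>S. (\<Sum>i\<in>I. if p = (c i, d i) then 1 else 0) * h p)"
    by (simp only: lookup)
  also have "\<dots> = (\<Sum>p\<in>S. \<Sum>i\<in>I. if p = (c i, d i) then h p else 0)"
    by (simp add: sum_distrib_right if_distrib[of "\<lambda>x. x * _"] cong: if_cong)
  also have "\<dots> = (\<Sum>i\<in>I. \<Sum>p\<in>S. if p = (c i, d i) then h p else 0)"
    by (rule sum.swap)
  also have "\<dots> = (\<Sum>i\<in>I. h (c i, d i))"
    using S by (intro sum.cong) (auto simp: S_def sum.delta)
  finally show ?thesis by (simp add: h_def)
qed

text \<open>The coproduct is computed on the chosen representative, which is a relabelling of
  \<open>D\<close> by some \<open>h\<close>. All contractions and complementations are transported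
  along \<open>h\<close>, and relabelling does not change classes.\<close>

lemma conv_basis:
  fixes f g :: "'k::field_char_0 hpe \<Rightarrow> 'k" and D :: "'a set_system"
  assumes D: "vf_safe D"
  shows "conv f g (basis D) = (\<Sum>A\<in>Pow (ground D).
    f (basis (contract_set D (ground D - A))) * g (basis (contract_set (loop_compl_set D A) A)))"
proof -
  note fin = delta_matroid_finite[OF vf_safe_imp_delta_matroid[OF D]]
  obtain h where h: "inj_on h (ground D)" and rep: "rep (class_of D) = relabel h D"
    using rep_class_of[OF D] dm_iso_iff_relabel by metis
  let ?c = "\<lambda>A. class_of (contract_set D (ground D - A))"
  let ?d = "\<lambda>A. class_of (contract_set (loop_compl_set D A) A)"
  have classes: "class_of (contract_set (relabel h D) (h ` ground D - h ` A)) = ?c A"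
      "class_of (contract_set (loop_compl_set (relabel h D) (h ` A)) (h ` A)) = ?d A"
    if A: "A \<subseteq> ground D" for A
  proof -
    have finA: "finite A" using A fin finite_subset by blast
    note dmD = vf_safe_imp_delta_matroid[OF D]
    have "h ` ground D - h ` A = h ` (ground D - A)"
      using inj_on_image_set_diff[OF h, of "ground D" A] A by auto
    then have "contract_set (relabel h D) (h ` ground D - h ` A) = relabel h (contract_set D (ground D - A))"
      using contract_set_relabel[OF D h] fin by simp
    moreover have "inj_on h (ground (contract_set D (ground D - A)))"
      using ground_contract_set[OF dmD] fin A h by (auto intro: inj_on_subset)
    moreover have "vf_safe (contract_set D (ground D - A))"
      using fin by (intro vf_safe_contract_set D) auto
    ultimately show "class_of (contract_set (relabel h D) (h ` ground D - h ` A)) = ?c A"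
      using class_of_relabel by metis
    have safe: "vf_safe (loop_compl_set D A)" using D finA A by (rule vf_safe_loop_compl_set)
    have "contract_set (loop_compl_set (relabel h D) (h ` A)) (h ` A) =
        relabel h (contract_set (loop_compl_set D A) A)"
      using loop_compl_set_relabel[OF D h finA A] contract_set_relabel[OF safe] finA A h by simp
    moreover have "inj_on h (ground (contract_set (loop_compl_set D A) A))"
      using ground_contract_set[OF vf_safe_imp_delta_matroid[OF safe]] finA A h
      by (auto intro: inj_on_subset)
    moreover have "vf_safe (contract_set (loop_compl_set D A) A)"
      using finA A by (intro vf_safe_contract_set safe) auto
    ultimately show "class_of (contract_set (loop_compl_set (relabel h D) (h ` A)) (h ` A)) = ?d A"
      using class_of_relabel by metis
  qed
  have "comult (basis D :: 'k hpe) =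
      (\<Sum>A\<in>Pow (h ` ground D). Poly_Mapping.single
        (class_of (contract_set (relabel h D) (h ` ground D - A)),
         class_of (contract_set (loop_compl_set (relabel h D) A) A)) 1)"
    by (simp add: comult_def basis_def rep)
  also have "Pow (h ` ground D) = (`) h ` Pow (ground D)"
    by (simp add: image_Pow_surj)
  also have "(\<Sum>A\<in>(`) h ` Pow (ground D). Poly_Mapping.single
        (class_of (contract_set (relabel h D) (h ` ground D - A)),
         class_of (contract_set (loop_compl_set (relabel h D) A) A)) (1::'k)) =
      (\<Sum>A\<in>Pow (ground D). Poly_Mapping.single (?c A, ?d A) 1)"
    using inj_on_image_Pow[OF h] by (simp add: sum.reindex classes)
  finally show ?thesis
    unfolding conv_def basis_def using fin by (simp add: mult_tensor_sum_single)
qed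

lemma dual_basis:
  "vf_safe X \<Longrightarrow> vf_safe D \<Longrightarrow> dual X (basis D) = (if dm_iso X D then 1 else 0)"
  using class_of_eq_iff[of X D] by (auto simp: dual_def basis_def lookup_single when_def)

section \<open>Additivity of the rank gap\<close>

text \<open>The integer \<open>2 * xi D A - card A\<close>, which keeps half-integers out of the
  argument until the polynomial enters.\<close>

definition gap :: "'a set_system \<Rightarrow> 'a set \<Rightarrow> int" where
  "gap D A = int (r_max (loop_compl_set D A)) - int (r_max D)"

lemma xi_eq_gap: "xi D A = of_int (int (card A) + gap D A) / 2"
  by (simp add: xi_def gap_def)

lemma abs_gap_le:
  assumes D: "vf_safe D"
  shows "\<bar>gap D (ground D)\<bar> \<le> int (card (ground D))"
proof -
  note fin = delta_matroid_finite[OF vf_safe_imp_delta_matroid[OF D]]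
  have "vf_safe (loop_compl_set D (ground D))"
    using D fin by (rule vf_safe_loop_compl_set) simp
  then show ?thesis
    using r_max_le_card_ground[OF vf_safe_imp_delta_matroid, of "loop_compl_set D (ground D)"]
      r_max_le_card_ground[OF vf_safe_imp_delta_matroid[OF D]]
    by (simp add: gap_def fin)
qed

text \<open>Contracting \<open>A\<close> lowers both maximal ranks by the same amount
  \<open>rho D A\<close>, since complementing \<open>B\<close> does not affect the traces on
  \<open>A\<close>.\<close>

lemma gap_contract_set:
  assumes D: "vf_safe D" and AB: "A \<union> B \<subseteq> ground D" "A \<inter> B = {}"
  shows "gap (contract_set D A) B = gap D B"
proof -
  have fin: "finite A" "finite B"
    using AB delta_matroid_finite[OF vf_safe_imp_delta_matroid[OF D]] finite_subset by blast+
  have safe: "vf_safe (loop_compl_set D B)"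
    using fin AB by (intro vf_safe_loop_compl_set D) auto
  have "loop_compl_set (contract_set D A) B = contract_set (loop_compl_set D B) A"
    using fin AB by (intro contract_set_loop_compl_set[symmetric] D) auto
  moreover have "r_max (contract_set (loop_compl_set D B) A) + rho D A = r_max (loop_compl_set D B)"
    using r_max_contract_set[OF vf_safe_imp_delta_matroid[OF safe], of A] fin AB
    by (simp add: rho_loop_compl_set)
  moreover have "r_max (contract_set D A) + rho D A = r_max D"
    using r_max_contract_set[OF vf_safe_imp_delta_matroid[OF D]] fin AB by simp
  ultimately show ?thesis by (simp add: gap_def)
qed

lemma gap_loop_compl_set:
  assumes "finite A" "finite B" "A \<inter> B = {}"
  shows "gap (loop_compl_set D A) B = gap D (A \<union> B) - gap D A"
  using assms by (simp add: gap_def loop_compl_set_union)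

text \<open>With \<open>s\<^sup>2 = x\<close> and \<open>t\<^sup>2 = y\<close> this is \<open>x\<close> to the power \<open>xi D\<close> times \<open>y\<close> to the power \<open>card E - xi D\<close>;
  both exponents are nonnegative by \<open>abs_gap_le\<close>, so \<open>nat\<close> does not truncate.\<close>
definition weight :: "'k::field_char_0 \<Rightarrow> 'k \<Rightarrow> 'a set_system \<Rightarrow> 'k" where
  "weight s t D = s ^ nat (int (card (ground D)) + gap D (ground D)) *
     t ^ nat (int (card (ground D)) - gap D (ground D))"

text \<open>\<open>left_part\<close> and \<open>right_part\<close> are the tensor factors of the
  coproduct summand at \<open>A\<close>, living on \<open>A\<close> and on its complement.\<close>

definition left_part :: "'a set_system \<Rightarrow> 'a set \<Rightarrow> 'a set_system" where
  "left_part D A = contract_set D (ground D - A)"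

definition right_part :: "'a set_system \<Rightarrow> 'a set \<Rightarrow> 'a set_system" where
  "right_part D A = contract_set (loop_compl_set D A) A"

context
  fixes D :: "'a set_system" and A :: "'a set"
  assumes D: "vf_safe D" and A: "A \<subseteq> ground D"
begin

lemma finite_parts: "finite (ground D)" "finite A"
  using A delta_matroid_finite[OF vf_safe_imp_delta_matroid[OF D]] finite_subset by blast+

lemma vf_safe_parts: "vf_safe (left_part D A)" "vf_safe (right_part D A)"
  using D A finite_parts unfolding left_part_def right_part_def
  by (auto intro!: vf_safe_contract_set vf_safe_loop_compl_set)

lemma ground_left_part: "ground (left_part D A) = A"
  using A finite_parts ground_contract_set[OF vf_safe_imp_delta_matroid[OF D], of "ground D - A"]
  by (auto simp: left_part_def)

lemma ground_right_part: "ground (right_part D A) = ground D - A"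
  using A finite_parts
    ground_contract_set[OF vf_safe_imp_delta_matroid[OF vf_safe_loop_compl_set[OF D]], of A A]
  by (simp add: right_part_def)

lemma card_ground_parts: "card A + card (ground D - A) = card (ground D)"
  using A finite_parts by (simp add: card_Diff_subset card_mono)

lemma gap_left_part: "gap (left_part D A) A = gap D A"
  unfolding left_part_def using A by (intro gap_contract_set D) auto

lemma gap_right_part: "gap (right_part D A) (ground D - A) = gap D (ground D) - gap D A"
proof -
  have safe: "vf_safe (loop_compl_set D A)"
    using finite_parts A by (intro vf_safe_loop_compl_set D)
  have "gap (right_part D A) (ground D - A) = gap (loop_compl_set D A) (ground D - A)"
    unfolding right_part_def using A finite_parts by (intro gap_contract_set safe) auto
  also have "\<dots> = gap D (ground D) - gap D A"
    using gap_loop_compl_set[of A "ground D - A" D] A finite_parts by (simp add: Un_absorb1)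
  finally show ?thesis .
qed

lemma abs_gap_left_le: "\<bar>gap D A\<bar> \<le> int (card A)"
  using abs_gap_le[OF vf_safe_parts(1)] by (simp add: ground_left_part gap_left_part)

lemma abs_gap_right_le: "\<bar>gap D (ground D) - gap D A\<bar> \<le> int (card (ground D - A))"
  using abs_gap_le[OF vf_safe_parts(2)] by (simp add: ground_right_part gap_right_part)

lemma weight_left_part: "weight s t (left_part D A) =
    s ^ nat (int (card A) + gap D A) * t ^ nat (int (card A) - gap D A)"
  by (simp add: weight_def ground_left_part gap_left_part)

lemma weight_right_part: "weight s t (right_part D A) =
    s ^ nat (int (card (ground D - A)) + (gap D (ground D) - gap D A)) *
    t ^ nat (int (card (ground D - A)) - (gap D (ground D) - gap D A))"
  by (simp add: weight_def ground_right_part gap_right_part)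

text \<open>The bounds on the gaps of the two parts make each integer nonnegative, so
  \<open>nat\<close> is additive here.\<close>

lemma exponents_add:
  "nat (int (card (ground D)) + gap D (ground D)) =
     nat (int (card A) + gap D A) + nat (int (card (ground D - A)) + (gap D (ground D) - gap D A))"
  "nat (int (card (ground D)) - gap D (ground D)) =
     nat (int (card A) - gap D A) + nat (int (card (ground D - A)) - (gap D (ground D) - gap D A))"
  using abs_gap_left_le abs_gap_right_le card_ground_parts by linarith+

text \<open>The product is independent of \<open>A\<close>, which is why all orderings of the ground
  set contribute equally to a convolution power.\<close>

lemma weight_parts: "weight s t (left_part D A) * weight s t (right_part D A) = weight s t D"
  unfolding weight_left_part weight_right_part
  by (simp add: weight_def exponents_add power_add mult_ac)

end

section \<open>The convolution exponential\<close>

text \<open>On one element the exchange property is automatic: \<open>u\<close> must be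
  \<open>x\<close>, and choosing \<open>v = u\<close> turns \<open>X\<close> into
  \<open>Y\<close>.\<close>

lemma vf_safe_singleton:
  assumes "S \<noteq> {}" "S \<subseteq> Pow {x}"
  shows "vf_safe ({x}, S)"
  unfolding vf_safe_def
proof (intro allI impI)
  fix D'
  assume "vf_reachable ({x}, S) D'"
  then have "ground D' = {x} \<and> feasible D' \<noteq> {} \<and> feasible D' \<subseteq> Pow {x}"
  proof induction
    case (loop_compl D' e)
    have "G \<subseteq> {x}" if "G \<in> feasible (loop_compl D' e)" for G
    proof -
      have "G \<subseteq> {x} \<or> G - {e} \<subseteq> {x}"
        using that loop_compl.IH by (auto simp: feasible_loop_compl_iff)
      then show ?thesis using loop_compl by auto
    qed
    then show ?case
      using feasible_loop_compl_nonempty[of D' e] loop_compl.IH by auto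
  qed (use assms in \<open>auto simp: twist_def\<close>)
  moreover have "\<exists>v\<in>sym_diff X Y. sym_diff X {u, v} \<in> F"
    if "F \<subseteq> Pow {x}" "X \<in> F" "Y \<in> F" "u \<in> sym_diff X Y" for F X Y u
  proof -
    have "u = x" "sym_diff X {u, u} = Y" using that by auto
    then show ?thesis using that by metis
  qed
  ultimately show "delta_matroid D'"
    unfolding delta_matroid_def by (intro conjI) auto
qed

lemma dm_iso_card: "dm_iso D D' \<Longrightarrow> card (ground D) = card (ground D')"
  by (auto simp: dm_iso_iff_relabel card_image)

lemma dm_iso_unit:
  "dm_iso ({()}, S) ({e}, T) \<longleftrightarrow> T = (`) (\<lambda>_. e) ` S"
proof -
  have "relabel f ({()}, S) = relabel (\<lambda>_. f ()) ({()}, S)" for f :: "unit \<Rightarrow> 'a"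
    by (simp add: relabel_def)
  then show ?thesis
    unfolding dm_iso_iff_relabel by (auto simp: relabel_def)
qed

lemma counit_basis:
  assumes "vf_safe D"
  shows "counit (basis D) = (if ground D = {} then 1 else 0)"
proof -
  note dm = vf_safe_imp_delta_matroid[OF assms]
  have "dm_iso ({} :: unit set, {{}}) D \<longleftrightarrow> ground D = {}"
  proof
    assume "ground D = {}"
    moreover from this have "feasible D = {{}}"
      using delta_matroid_nonempty[OF dm] delta_matroid_subset[OF dm] by auto
    ultimately show "dm_iso ({} :: unit set, {{}}) D"
      by (auto simp: dm_iso_iff_relabel relabel_def prod_eq_iff)
  qed (use delta_matroid_finite[OF dm] in \<open>auto dest: dm_iso_card\<close>)
  then show ?thesis
    by (simp add: counit_def dual_basis vf_safe_empty assms)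
qed

text \<open>Parametrised by the square roots, so that \<open>delta_a\<close> and
  \<open>delta_b\<close> are both instances and all coefficients are monomials in \<open>s\<close>
  and \<open>t\<close>.\<close>

definition delta :: "'k::field_char_0 \<Rightarrow> 'k \<Rightarrow> 'k hpe \<Rightarrow> 'k" where
  "delta s t v = (s * t) * delta_c v + s\<^sup>2 * delta_o v + t\<^sup>2 * delta_n v"

text \<open>The gap is 1 for the loop, 0 for the coloop and -1 when both subsets are feasible,
  giving the weights \<open>s\<^sup>2\<close>, \<open>s * t\<close> and
  \<open>t\<^sup>2\<close>.\<close>

lemma delta_basis:
  fixes s t :: "'k::field_char_0"
  assumes D: "vf_safe D"
  shows "delta s t (basis D) = (if card (ground D) = 1 then weight s t D else 0)"
proof -
  note dm = vf_safe_imp_delta_matroid[OF D]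
  have deltas: "delta_c (basis D :: 'k hpe) = (if dm_iso ({()}, {{()}}) D then 1 else 0)"
    "delta_o (basis D :: 'k hpe) = (if dm_iso ({()}, {{}}) D then 1 else 0)"
    "delta_n (basis D :: 'k hpe) = (if dm_iso ({()}, {{}, {()}}) D then 1 else 0)"
    unfolding delta_c_def delta_o_def delta_n_def
    by (rule dual_basis[OF vf_safe_singleton D]; simp)+
  show ?thesis
  proof (cases "card (ground D) = 1")
    case False
    then have "\<not> dm_iso ({()}, S) D" for S
      using dm_iso_card[of "({()}, S)" D] by auto
    then show ?thesis using False by (simp add: delta_def deltas)
  next
    case True
    then obtain e where e: "ground D = {e}" using card_1_singletonE by blast
    have "feasible D \<subseteq> {{}, {e}}" "feasible D \<noteq> {}"
      using delta_matroid_subset[OF dm] delta_matroid_nonempty[OF dm] e by auto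
    then consider "feasible D = {{}}" | "feasible D = {{e}}" | "feasible D = {{}, {e}}"
      by blast
    then have "D = ({e}, {{}}) \<or> D = ({e}, {{e}}) \<or> D = ({e}, {{}, {e}})"
      using e by cases (auto simp: prod_eq_iff)
    then show ?thesis
    proof (elim disjE)
      assume D_eq: "D = ({e}, {{}})"
      have "loop_compl ({e}, {{}}) e = ({e}, {{}, {e}})"
        by (auto simp: loop_compl_def)
      then show ?thesis
        unfolding delta_def deltas
        by (simp add: D_eq dm_iso_unit weight_def gap_def r_max_def power_mult_distrib)
    next
      assume D_eq: "D = ({e}, {{e}})"
      have "loop_compl ({e}, {{e}}) e = ({e}, {{e}})"
        by (auto simp: loop_compl_def)
      then show ?thesis
        unfolding delta_def deltas
        by (simp add: D_eq dm_iso_unit weight_def gap_def r_max_def power_mult_distrib)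
    next
      assume D_eq: "D = ({e}, {{}, {e}})"
      have "loop_compl ({e}, {{}, {e}}) e = ({e}, {{}})"
        by (auto simp: loop_compl_def)
      then show ?thesis
        unfolding delta_def deltas
        by (simp add: D_eq dm_iso_unit weight_def gap_def r_max_def power_mult_distrib)
    qed
  qed
qed

text \<open>In one more convolution only the singletons \<open>A\<close> survive. They leave right
  parts on one element fewer, and each contributes \<open>fact k\<close> times the same weight by
  \<open>weight_parts\<close>; their number supplies the factor \<open>k + 1\<close>.\<close>

lemma conv_pow_delta_basis:
  assumes "vf_safe D"
  shows "conv_pow (delta s t) k (basis D) =
    (if k = card (ground D) then fact k * weight s t D else 0)"
  using assms
proof (induction k arbitrary: D)
  case 0
  note fin = delta_matroid_finite[OF vf_safe_imp_delta_matroid[OF 0]]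
  have "weight s t D = 1" if "ground D = {}"
    using that by (simp add: weight_def gap_def)
  then show ?case
    using fin by (simp add: conv_pow_def counit_basis[OF 0])
next
  case (Suc k)
  note fin = delta_matroid_finite[OF vf_safe_imp_delta_matroid[OF Suc.prems]]
  let ?n = "card (ground D)"
  have "conv_pow (delta s t) (Suc k) (basis D) = conv (delta s t) (conv_pow (delta s t) k) (basis D)"
    by (simp add: conv_pow_def)
  also have "\<dots> = (\<Sum>A\<in>Pow (ground D). delta s t (basis (left_part D A)) *
      conv_pow (delta s t) k (basis (right_part D A)))"
    by (simp add: conv_basis[OF Suc.prems] left_part_def right_part_def)
  also have "\<dots> = (\<Sum>A\<in>Pow (ground D). if card A = 1 then
      (if Suc k = ?n then fact k * weight s t D else 0) else 0)"
  proof (rule sum.cong)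
    fix A
    assume "A \<in> Pow (ground D)"
    then have A: "A \<subseteq> ground D" by simp
    note safe = vf_safe_parts[OF Suc.prems A]
    show "delta s t (basis (left_part D A)) * conv_pow (delta s t) k (basis (right_part D A)) =
      (if card A = 1 then (if Suc k = ?n then fact k * weight s t D else 0) else 0)"
      using card_ground_parts[OF Suc.prems A] weight_parts[OF Suc.prems A, of s t]
      by (simp add: delta_basis[OF safe(1)] Suc.IH[OF safe(2)] ground_left_part[OF Suc.prems A]
          ground_right_part[OF Suc.prems A])
  qed simp
  also have "\<dots> = of_nat (card {A \<in> Pow (ground D). card A = 1}) *
      (if Suc k = ?n then fact k * weight s t D else 0)"
    using fin by (simp add: sum.If_cases Int_def)
  also have "card {A \<in> Pow (ground D). card A = 1} = ?n"
    using n_subsets[OF fin, of 1] by simp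
  finally have eq: "conv_pow (delta s t) (Suc k) (basis D) =
      of_nat ?n * (if Suc k = ?n then fact k * weight s t D else 0)" .
  show ?case
  proof (cases "Suc k = ?n")
    case True
    then show ?thesis unfolding eq by (simp add: algebra_simps flip: True)
  qed (simp add: eq)
qed

lemma conv_exp_delta_basis:
  assumes "vf_safe D"
  shows "conv_exp (delta s t) (basis D) = weight s t D"
proof -
  have eq: "(\<lambda>k. conv_pow (delta s t) k (basis D) / fact k) =
      (\<lambda>k. weight s t D when k = card (ground D))"
    by (auto simp: conv_pow_delta_basis[OF assms] when_def)
  show ?thesis unfolding conv_exp_def eq by (rule Sum_any_when_equal)
qed

section \<open>Half-integral powers and the comparison of monomials\<close>

text \<open>Holds for \<open>s = 0\<close> as well: there \<open>0 powi 0 = 1\<close>, and the factor \<open>s\<close> kills the odd powers.\<close>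
lemma half_pow_half:
  assumes "n \<ge> 0"
  shows "half_pow (s\<^sup>2) s (of_int n / 2) = s ^ nat n"
proof (cases "even n")
  case True
  then obtain m where m: "n = 2 * m" by blast
  then have "half_pow (s\<^sup>2) s (of_int n / 2) = s\<^sup>2 powi m" by (simp add: half_pow_def)
  also have "\<dots> = s ^ nat n"
    using assms m by (simp add: power_int_def nat_mult_distrib power_mult)
  finally show ?thesis .
next
  case False
  then obtain m where m: "n = 2 * m + 1" using oddE by blast
  then have half: "of_int n / 2 = (of_int m + 1 / 2 :: rat)" by (simp add: field_simps)
  then have floor: "\<lfloor>of_int n / 2 :: rat\<rfloor> = m" by (simp add: floor_eq_iff)
  have "of_int n / 2 \<notin> (\<int> :: rat set)"
  proof
    assume "of_int n / 2 \<in> (\<int> :: rat set)"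
    then obtain z where "of_int n / 2 = (of_int z :: rat)" by (rule Ints_cases)
    then have "(of_int n :: rat) = of_int (2 * z)" by simp
    then show False using False by (simp only: of_int_eq_iff) simp
  qed
  then have "half_pow (s\<^sup>2) s (of_int n / 2) = s\<^sup>2 powi m * s"
    by (simp add: half_pow_def floor)
  moreover have "nat n = 2 * nat m + 1" "m \<ge> 0" using assms m by linarith+
  ultimately show ?thesis
    by (simp add: power_int_def power_mult)
qed

theorem theorem3p56:
  fixes D :: "'a set_system"
    and x1 x2 y1 y2 :: "'k::field_char_0"
    and sqrt_x1 sqrt_x2 sqrt_y1 sqrt_y2 :: 'k
    and delta_a delta_b :: "'k hpe \<Rightarrow> 'k"
  assumes "vf_safe D"
    and "sqrt_x1 ^ 2 = x1" and "sqrt_x2 ^ 2 = x2"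
    and "sqrt_y1 ^ 2 = y1" and "sqrt_y2 ^ 2 = y2"
    and "x1 \<noteq> 0" and "y2 \<noteq> 0"
    and "delta_a = (\<lambda>v. (sqrt_x1 * sqrt_x2) * delta_c v + x1 * delta_o v + x2 * delta_n v)"
    and "delta_b = (\<lambda>v. (sqrt_y1 * sqrt_y2) * delta_c v + y1 * delta_o v + y2 * delta_n v)"
  shows "conv (conv_exp delta_a) (conv_exp delta_b) (basis D) =
    half_pow x1 sqrt_x1 (xi D (ground D)) *
    half_pow y2 sqrt_y2 (of_nat (card (ground D)) - xi D (ground D)) *
    P_tilde D (y1 / x1 + 1) (sqrt_y1 / sqrt_x1) (x2 / y2 + 1) (sqrt_x2 / sqrt_y2)"
proof -
  note D = assms(1)
  let ?E = "ground D"
  let ?n = "int (card ?E)" and ?g = "gap D ?E"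
  have nz: "sqrt_x1 \<noteq> 0" "sqrt_y2 \<noteq> 0" using assms by auto
  have delta: "delta_a = delta sqrt_x1 sqrt_x2" "delta_b = delta sqrt_y1 sqrt_y2"
    using assms(2-5) by (simp_all add: assms(8,9) delta_def fun_eq_iff)
  have pow_a: "half_pow x1 sqrt_x1 (xi D ?E) = sqrt_x1 ^ nat (?n + ?g)"
    unfolding xi_eq_gap assms(2)[symmetric] using abs_gap_le[OF D] by (intro half_pow_half) linarith
  have co_xi: "of_nat (card A) - xi D A = of_int (int (card A) - gap D A) / 2" for A
    by (simp add: xi_eq_gap field_simps)
  have pow_b: "half_pow y2 sqrt_y2 (of_nat (card ?E) - xi D ?E) = sqrt_y2 ^ nat (?n - ?g)"
    unfolding co_xi assms(5)[symmetric] using abs_gap_le[OF D] by (intro half_pow_half) linarith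
  \<comment> \<open>The roots passed to \<open>P_tilde\<close> are quotients of the given ones, so
    every half-integral power becomes an ordinary power of these four roots or their
    quotients.\<close>
  have ratios: "y1 / x1 = (sqrt_y1 / sqrt_x1)\<^sup>2" "x2 / y2 = (sqrt_x2 / sqrt_y2)\<^sup>2"
    by (simp_all add: power_divide assms(2-5))
  have "conv (conv_exp delta_a) (conv_exp delta_b) (basis D) =
      (\<Sum>A\<in>Pow ?E. conv_exp delta_a (basis (left_part D A)) * conv_exp delta_b (basis (right_part D A)))"
    by (simp add: conv_basis[OF D] left_part_def right_part_def)
  also have "\<dots> = (\<Sum>A\<in>Pow ?E. sqrt_x1 ^ nat (?n + ?g) * sqrt_y2 ^ nat (?n - ?g) *
      (half_pow (y1 / x1) (sqrt_y1 / sqrt_x1) (xi D ?E - xi D A) *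
       half_pow (x2 / y2) (sqrt_x2 / sqrt_y2) (of_nat (card A) - xi D A)))"
  proof (rule sum.cong)
    fix A
    assume "A \<in> Pow ?E"
    then have A: "A \<subseteq> ?E" by simp
    let ?m = "int (card A)" and ?c = "int (card (?E - A))" and ?h = "gap D A"
    note safe = vf_safe_parts[OF D A]
    \<comment> \<open>The numerator is the exponent of \<open>sqrt_y1\<close> in the weight of the
      right part.\<close>
    have xi_diff: "xi D ?E - xi D A = of_int (?c + (?g - ?h)) / 2"
      using arg_cong[OF card_ground_parts[OF D A], of "of_nat :: nat \<Rightarrow> rat"]
      by (simp add: xi_eq_gap field_simps)
    have 1: "half_pow (y1 / x1) (sqrt_y1 / sqrt_x1) (xi D ?E - xi D A) =
        (sqrt_y1 / sqrt_x1) ^ nat (?c + (?g - ?h))"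
      unfolding xi_diff ratios using abs_gap_right_le[OF D A] by (intro half_pow_half) linarith
    have 2: "half_pow (x2 / y2) (sqrt_x2 / sqrt_y2) (of_nat (card A) - xi D A) =
        (sqrt_x2 / sqrt_y2) ^ nat (?m - ?h)"
      unfolding co_xi ratios using abs_gap_left_le[OF D A] by (intro half_pow_half) linarith
    \<comment> \<open>By \<open>exponents_add\<close> the prefactors split over the two parts. The
      quotients then replace \<open>sqrt_x1\<close> by \<open>sqrt_y1\<close> in the share of the
      right part, and \<open>sqrt_y2\<close> by \<open>sqrt_x2\<close> in the share of the left
      part.\<close>
    show "conv_exp delta_a (basis (left_part D A)) * conv_exp delta_b (basis (right_part D A)) =
      sqrt_x1 ^ nat (?n + ?g) * sqrt_y2 ^ nat (?n - ?g) *
      (half_pow (y1 / x1) (sqrt_y1 / sqrt_x1) (xi D ?E - xi D A) *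
       half_pow (x2 / y2) (sqrt_x2 / sqrt_y2) (of_nat (card A) - xi D A))"
      unfolding 1 2 delta conv_exp_delta_basis[OF safe(1)] conv_exp_delta_basis[OF safe(2)]
        weight_left_part[OF D A] weight_right_part[OF D A] exponents_add[OF D A]
      using nz by (simp add: power_add power_divide)
  qed simp
  also have "\<dots> = half_pow x1 sqrt_x1 (xi D ?E) *
      half_pow y2 sqrt_y2 (of_nat (card ?E) - xi D ?E) *
      P_tilde D (y1 / x1 + 1) (sqrt_y1 / sqrt_x1) (x2 / y2 + 1) (sqrt_x2 / sqrt_y2)"
    by (simp add: P_tilde_def pow_a pow_b sum_distrib_left)
  finally show ?thesis .
qed

end
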